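(* Let $y>x>x'\ge 0$ be real numbers, let $\gamma=\frac12$ (the arbiter is a fair coin toss), and let $\lambda=x$. Then the escrow contract with parameters $(x,x',y,\gamma,\lambda)$ has weak game-theoretic security, i.e. the honest strategy profile $s^*$ is a subgame perfect equilibrium of the contract game.
   Context: The escrow contract: a seller $S$ sells an item to a buyer $B$ for price $x$; the item is worth $y$ to $B$ and $x'$ to $S$, with $y>x>x'$. The arbiter errs (rules against the honest party) with probability $\gamma$. The wager size is $\lambda>0$. The contract is the following two-player extensive-form game of perfect information. 1. $S$ chooses send or not send. 2. $B$ observes this and chooses accept or dispute. If $B$ accepts, the game ends. 3. If $B$ disputes, $S$ chooses forfeit or counter, and the game ends. Payoffs (buyer, seller): (send, accept): $(y-x,\ x-x')$; (send, dispute, forfeit): $(y,\ -x')$; (send, dispute, counter): $(y\gamma-(x+\lambda)(1-\gamma),\ x(1-\gamma)-\lambda\gamma-x')$; (not send, accept): $(-x,\ x)$; (not send, dispute, forfeit): $(0,\ 0)$; (not send, dispute, counter): $(-(x+\lambda)\gamma,\ x\gamma-\lambda(1-\gamma))$. A (pure) strategy of a player prescribes an action at each of that player's decision nodes. The honest strategy profile $s^*$ is: $S$ plays send, counters a dispute after send, and forfeits a dispute after not send; $B$ accepts after send and disputes after not send. The contract has weak game-theoretic security if $s^*$ is a (not necessarily unique) subgame perfect equilibrium. *)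

theory Defs
  imports Complex_Main
begin

(* Finite-horizon extensive-form games of perfect information: "Decision i A f" is a node where
   player i picks an action from A, and f a is the game that follows a.
   Values of f outside A are irrelevant. *)
datatype ('p, 'a) game =
    Terminal "'p \<Rightarrow> real"
  | Decision 'p "'a set" "'a \<Rightarrow> ('p, 'a) game"

(* A decision node is identified with the list of actions leading to it from the root,
   earliest action first. *)
type_synonym 'a strategy = "'a list \<Rightarrow> 'a"
type_synonym ('p, 'a) profile = "'p \<Rightarrow> 'a strategy"

primrec histories :: "('p, 'a) game \<Rightarrow> 'a list set" where
  "histories (Terminal u) = {[]}"
| "histories (Decision i A f) = insert [] (\<Union>a\<in>A. (#) a ` histories (f a))"

(* Only meaningful on histories of the game; the last equation is a dummy. *)
fun subgame :: "('p, 'a) game \<Rightarrow> 'a list \<Rightarrow> ('p, 'a) game" where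
  "subgame G [] = G"
| "subgame (Decision i A f) (a # h) = subgame (f a) h"
| "subgame (Terminal u) (a # h) = Terminal u"

definition strategy_of :: "('p, 'a) game \<Rightarrow> 'p \<Rightarrow> 'a strategy \<Rightarrow> bool" where
  "strategy_of G i \<sigma> \<longleftrightarrow>
     (\<forall>h \<in> histories G. \<forall>A f. subgame G h = Decision i A f \<longrightarrow> \<sigma> h \<in> A)"

definition profile_of :: "('p, 'a) game \<Rightarrow> ('p, 'a) profile \<Rightarrow> bool" where
  "profile_of G s \<longleftrightarrow> (\<forall>i. strategy_of G i (s i))"

definition restrict_profile :: "('p, 'a) profile \<Rightarrow> 'a list \<Rightarrow> ('p, 'a) profile" where
  "restrict_profile s h = (\<lambda>i h'. s i (h @ h'))"

primrec payoff :: "('p, 'a) game \<Rightarrow> ('p, 'a) profile \<Rightarrow> 'p \<Rightarrow> real" where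
  "payoff (Terminal u) s = u"
| "payoff (Decision i A f) s = payoff (f (s i [])) (restrict_profile s [s i []])"

definition nash_equilibrium :: "('p, 'a) game \<Rightarrow> ('p, 'a) profile \<Rightarrow> bool" where
  "nash_equilibrium G s \<longleftrightarrow> profile_of G s \<and>
     (\<forall>i \<sigma>. strategy_of G i \<sigma> \<longrightarrow> payoff G (s(i := \<sigma>)) i \<le> payoff G s i)"

definition subgame_perfect_equilibrium :: "('p, 'a) game \<Rightarrow> ('p, 'a) profile \<Rightarrow> bool" where
  "subgame_perfect_equilibrium G s \<longleftrightarrow> profile_of G s \<and>
     (\<forall>h \<in> histories G. nash_equilibrium (subgame G h) (restrict_profile s h))"

datatype player = Buyer | Seller
datatype action = Send | NotSend | Accept | Dispute | Forfeit | Counter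

fun payoffs :: "real \<Rightarrow> real \<Rightarrow> player \<Rightarrow> real" where
  "payoffs b s Buyer = b"
| "payoffs b s Seller = s"

(* x: price; x': value to the seller; y: value to the buyer;
   \<gamma>: error probability of the arbiter; w: size of the wager *)
definition escrow_game :: "real \<Rightarrow> real \<Rightarrow> real \<Rightarrow> real \<Rightarrow> real \<Rightarrow> (player, action) game" where
  "escrow_game x x' y \<gamma> w =
     Decision Seller {Send, NotSend} (\<lambda>a.
       if a = Send then
         Decision Buyer {Accept, Dispute} (\<lambda>b.
           if b = Accept then Terminal (payoffs (y - x) (x - x'))
           else Decision Seller {Forfeit, Counter} (\<lambda>c.
             if c = Forfeit then Terminal (payoffs y (- x'))
             else Terminal (payoffs (y * \<gamma> - (x + w) * (1 - \<gamma>))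
                                    (x * (1 - \<gamma>) - w * \<gamma> - x'))))
       else
         Decision Buyer {Accept, Dispute} (\<lambda>b.
           if b = Accept then Terminal (payoffs (- x) x)
           else Decision Seller {Forfeit, Counter} (\<lambda>c.
             if c = Forfeit then Terminal (payoffs 0 0)
             else Terminal (payoffs (- (x + w) * \<gamma>)
                                    (x * \<gamma> - w * (1 - \<gamma>))))))"

(* The values at lists that are not decision nodes of the respective player are irrelevant. *)
definition honest_profile :: "(player, action) profile" where
  "honest_profile i h =
     (case i of
        Seller \<Rightarrow>
          if h = [] then Send
          else if h = [Send, Dispute] then Counter
          else if h = [NotSend, Dispute] then Forfeit
          else undefined
      | Buyer \<Rightarrow>
          if h = [Send] then Accept
          else if h = [NotSend] then Dispute
          else undefined)"

definition weak_game_theoretic_security ::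
    "real \<Rightarrow> real \<Rightarrow> real \<Rightarrow> real \<Rightarrow> real \<Rightarrow> bool" where
  "weak_game_theoretic_security x x' y \<gamma> w \<longleftrightarrow>
     subgame_perfect_equilibrium (escrow_game x x' y \<gamma> w) honest_profile"

end

theory Submission
  imports Defs
begin

text \<open>Backward induction, with \<open>subgame_perfect_DecisionI\<close> as the induction step.
  For a fair coin and wager x, countering and forfeiting tie at both final nodes (-x' after
  \<open>Send\<close>, 0 after \<open>NotSend\<close>), so either choice is optimal there. Given the
  honest replies, the buyer compares y - x with y/2 - x after \<open>Send\<close>, and 0 with -x
  after \<open>NotSend\<close>; the seller compares x - x' with 0 at the root. All follow from y > x
  > x' \<ge> 0.\<close>

lemma strategy_of_Terminal [simp]: "strategy_of (Terminal u) i \<sigma>"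
  by (simp add: strategy_of_def)

lemma strategy_of_Decision:
  "strategy_of (Decision i A f) j \<sigma> \<longleftrightarrow>
     (i = j \<longrightarrow> \<sigma> [] \<in> A) \<and> (\<forall>a\<in>A. strategy_of (f a) j (\<lambda>h. \<sigma> (a # h)))"
  by (auto simp: strategy_of_def)

lemma restrict_profile_Nil [simp]: "restrict_profile s [] = s"
  by (simp add: restrict_profile_def)

lemma restrict_profile_Cons:
  "restrict_profile s (a # h) = restrict_profile (restrict_profile s [a]) h"
  by (simp add: restrict_profile_def)

text \<open>Turns a unilateral deviation in the whole game into one in the subgame after
  \<open>a\<close>, where the Nash property applies.\<close>

lemma restrict_profile_upd:
  "restrict_profile (s(i := \<sigma>)) [a] = (restrict_profile s [a])(i := \<lambda>h. \<sigma> (a # h))"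
  by (auto simp: restrict_profile_def)

lemma Nil_in_histories [simp]: "[] \<in> histories G"
  by (cases G) auto

lemma subgame_perfect_imp_nash:
  assumes "subgame_perfect_equilibrium G s"
  shows "nash_equilibrium G s"
  using assms unfolding subgame_perfect_equilibrium_def
  by (metis Nil_in_histories restrict_profile_Nil subgame.simps(1))

lemma subgame_perfect_Terminal [simp]: "subgame_perfect_equilibrium (Terminal u) s"
  by (simp add: subgame_perfect_equilibrium_def nash_equilibrium_def profile_of_def)

text \<open>One-shot deviation principle: once all subgames are in equilibrium, only the first move
  needs checking, against the payoffs of continuing with \<open>s\<close>.\<close>

lemma subgame_perfect_DecisionI:
  assumes mem: "s i [] \<in> A"
    and sub: "\<And>a. a \<in> A \<Longrightarrow> subgame_perfect_equilibrium (f a) (restrict_profile s [a])"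
    and opt: "\<And>a. a \<in> A \<Longrightarrow> payoff (f a) (restrict_profile s [a]) i
                \<le> payoff (f (s i [])) (restrict_profile s [s i []]) i"
  shows "subgame_perfect_equilibrium (Decision i A f) s"
proof -
  let ?G = "Decision i A f"
  have nash: "nash_equilibrium (f a) (restrict_profile s [a])" if "a \<in> A" for a
    using subgame_perfect_imp_nash sub that by blast
  have prof: "profile_of ?G s"
    using mem nash
    by (auto simp: profile_of_def strategy_of_Decision nash_equilibrium_def restrict_profile_def)
  have dev: "payoff (f a) (restrict_profile (s(j := \<sigma>)) [a]) j
      \<le> payoff (f a) (restrict_profile s [a]) j"
    if "strategy_of ?G j \<sigma>" "a \<in> A" for a j \<sigma>
    using nash[OF that(2)] that
    by (simp add: nash_equilibrium_def restrict_profile_upd strategy_of_Decision)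
  have "payoff ?G (s(j := \<sigma>)) j \<le> payoff ?G s j" if \<sigma>: "strategy_of ?G j \<sigma>" for j \<sigma>
  \<comment> \<open>If \<open>j\<close> moves first, the deviation opens with some \<open>a\<close>;
    \<open>dev\<close> bounds it by following \<open>s\<close> after \<open>a\<close>, and
    \<open>opt\<close> bounds that by the payoff of \<open>s\<close>. Otherwise the first move is
    unchanged and \<open>dev\<close> suffices.\<close>
  proof (cases "j = i")
    case True
    then have "\<sigma> [] \<in> A"
      using \<sigma> by (simp add: strategy_of_Decision)
    then show ?thesis
      using dev[OF \<sigma>] opt True by fastforce
  next
    case False
    then show ?thesis
      using dev[OF \<sigma> mem] by simp
  qed
  with prof have "nash_equilibrium ?G s"
    by (simp add: nash_equilibrium_def)
  moreover have "nash_equilibrium (subgame (f a) h) (restrict_profile s (a # h))"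
    if "a \<in> A" "h \<in> histories (f a)" for a h
    using sub[OF that(1)] that(2)
    by (simp add: subgame_perfect_equilibrium_def restrict_profile_Cons[of s a h])
  ultimately show ?thesis
    using prof by (auto simp: subgame_perfect_equilibrium_def)
qed

theorem theorem4:
  fixes x x' y \<gamma> w :: real
  assumes "y > x" and "x > x'" and "x' \<ge> 0"
    and "\<gamma> = 1 / 2" and "w = x"
  shows "weak_game_theoretic_security x x' y \<gamma> w"
  unfolding weak_game_theoretic_security_def escrow_game_def assms(4,5)
  using assms(1-3)
  \<comment> \<open>The rule is applied at every decision node, leaving the payoff comparisons as
    linear inequalities.\<close>
  by (auto intro!: subgame_perfect_DecisionI
      simp: honest_profile_def restrict_profile_def)

end
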